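(* Let $P$ be a poset, $\prec$ an auxiliary relation on $P$ and $A\subseteq P$. Then: (1) $A^{\downarrow\prec}\cup(P\setminus A)^{\uparrow\prec}=P$. (2) If moreover $A$ is an upper set, then $A^{\downarrow\prec}\cap(P\setminus A)^{\uparrow\prec}=\emptyset$; so $A^{\downarrow\prec}$ and $(P\setminus A)^{\uparrow\prec}$ partition $P$.
   Context: For a poset $(P,\le)$, $\mathord{\downarrow}X=\{x\mid\exists y\in X,\ x\le y\}$; $A$ is upper if $x\in A$, $x\le y$ imply $y\in A$. An auxiliary relation on $P$ is a binary relation $\prec$ such that: $x\prec y$ implies $x\le y$; $u\le x\prec y\le z$ implies $u\prec z$; if $P$ has a least element $\bot$ then $\bot\prec x$ for all $x$. Write $s_\prec(x)=\{y\mid y\prec x\}$. $A^{\downarrow\prec}=\{x\in A\mid s_\prec(x)\cap A\ne\emptyset\}$, $A^{\uparrow\prec}=\{x\in P\mid s_\prec(x)\subseteq\mathord{\downarrow}A\}$. *)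

theory Defs
  imports Main
begin

text \<open>
  A poset is a carrier set \<open>P\<close> with an order relation \<open>r\<close> such that \<open>partial_order_on P r\<close>;
  \<open>(x, y) \<in> r\<close> stands for \<open>x \<le> y\<close>. An auxiliary relation is likewise a set of pairs \<open>prec\<close>,
  with \<open>(x, y) \<in> prec\<close> for \<open>x \<prec> y\<close>. The explicit carrier also admits the empty poset.
\<close>

definition down_closure :: "'a set \<Rightarrow> 'a rel \<Rightarrow> 'a set \<Rightarrow> 'a set" where
  "down_closure P r X = {x \<in> P. \<exists>y\<in>X. (x, y) \<in> r}"

definition upper_set :: "'a set \<Rightarrow> 'a rel \<Rightarrow> 'a set \<Rightarrow> bool" where
  "upper_set P r A \<longleftrightarrow> A \<subseteq> P \<and> (\<forall>x\<in>A. \<forall>y\<in>P. (x, y) \<in> r \<longrightarrow> y \<in> A)"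

definition auxiliary_relation :: "'a set \<Rightarrow> 'a rel \<Rightarrow> 'a rel \<Rightarrow> bool" where
  "auxiliary_relation P r prec \<longleftrightarrow>
     prec \<subseteq> P \<times> P \<and>
     (\<forall>x\<in>P. \<forall>y\<in>P. (x, y) \<in> prec \<longrightarrow> (x, y) \<in> r) \<and>
     (\<forall>u\<in>P. \<forall>x\<in>P. \<forall>y\<in>P. \<forall>z\<in>P.
        (u, x) \<in> r \<and> (x, y) \<in> prec \<and> (y, z) \<in> r \<longrightarrow> (u, z) \<in> prec) \<and>
     (\<forall>b\<in>P. (\<forall>x\<in>P. (b, x) \<in> r) \<longrightarrow> (\<forall>x\<in>P. (b, x) \<in> prec))"

definition aux_below :: "'a set \<Rightarrow> 'a rel \<Rightarrow> 'a \<Rightarrow> 'a set" where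
  "aux_below P prec x = {y \<in> P. (y, x) \<in> prec}"

text \<open>The sets \<open>A\<^sup>\<down>\<^sup>\<prec>\<close> and \<open>A\<^sup>\<up>\<^sup>\<prec>\<close>, in this order.\<close>

definition aux_down :: "'a set \<Rightarrow> 'a rel \<Rightarrow> 'a set \<Rightarrow> 'a set" where
  "aux_down P prec A = {x \<in> A. aux_below P prec x \<inter> A \<noteq> {}}"

definition aux_up :: "'a set \<Rightarrow> 'a rel \<Rightarrow> 'a rel \<Rightarrow> 'a set \<Rightarrow> 'a set" where
  "aux_up P r prec A = {x \<in> P. aux_below P prec x \<subseteq> down_closure P r A}"

end

theory Submission
  imports Defs
begin

text \<open>Whether \<open>x\<close> lies in \<open>aux_down P prec A\<close> depends on
  \<open>A\<close> meeting the set of points \<open>prec\<close>-below \<open>x\<close>. If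
  \<open>x\<close> is in \<open>A\<close> and this set misses \<open>A\<close>, it lies in
  \<open>P - A\<close>, hence in its down-closure. If \<open>x\<close> is not in \<open>A\<close>,
  everything \<open>prec\<close>-below \<open>x\<close> is \<le> \<open>x\<close>, a point of
  \<open>P - A\<close>. So the union is \<open>P\<close>. Disjointness comes from
  \<open>down_closure_Diff_upper_set\<close>.\<close>

lemma aux_down_Un_aux_up:
  assumes "partial_order_on P r" and "auxiliary_relation P r prec" and "A \<subseteq> P"
  shows "aux_down P prec A \<union> aux_up P r prec (P - A) = P"
proof
  show "aux_down P prec A \<union> aux_up P r prec (P - A) \<subseteq> P"
    using assms(3) by (auto simp: aux_down_def aux_up_def)
next
  show "P \<subseteq> aux_down P prec A \<union> aux_up P r prec (P - A)"
  proof
    fix x assume x: "x \<in> P"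
    have refl: "(y, y) \<in> r" if "y \<in> P" for y
      using assms(1) that unfolding partial_order_on_def preorder_on_def refl_on_def by blast
    have le: "(y, x) \<in> r" if "y \<in> aux_below P prec x" for y
      using assms(2) that x unfolding auxiliary_relation_def aux_below_def by blast
    have sub: "aux_below P prec x \<subseteq> P"
      unfolding aux_below_def by blast
    have "x \<in> aux_up P r prec (P - A)" if nd: "x \<notin> aux_down P prec A"
    proof (cases "x \<in> A")
      case True
      with nd have "aux_below P prec x \<inter> A = {}"
        unfolding aux_down_def by blast
      \<comment> \<open>By reflexivity, each \<open>y\<close> in \<open>aux_below P prec x\<close>
        is its own upper bound in \<open>P - A\<close>.\<close>
      with x refl sub show ?thesis
        unfolding aux_up_def down_closure_def by blast
    next
      case False
      \<comment> \<open>Here \<open>x\<close> itself is the upper bound in \<open>P - A\<close>, by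
        \<open>le\<close>.\<close>
      with x le sub show ?thesis
        unfolding aux_up_def down_closure_def by blast
    qed
    then show "x \<in> aux_down P prec A \<union> aux_up P r prec (P - A)" by blast
  qed
qed

text \<open>A point of \<open>A\<close> below some \<open>y\<close> in \<open>P - A\<close> would
  force \<open>y\<close> into \<open>A\<close>.\<close>

lemma down_closure_Diff_upper_set:
  assumes "upper_set P r A"
  shows "down_closure P r (P - A) \<inter> A = {}"
  using assms by (auto simp: upper_set_def down_closure_def)

text \<open>For a common point \<open>x\<close>, a witness in
  \<open>aux_below P prec x \<inter> A\<close> would also lie in the down-closure of
  \<open>P - A\<close>.\<close>

lemma aux_down_Int_aux_up:
  assumes "upper_set P r A"
  shows "aux_down P prec A \<inter> aux_up P r prec (P - A) = {}"
  using down_closure_Diff_upper_set[OF assms] by (auto simp: aux_down_def aux_up_def)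

theorem theorem3p8:
  fixes P A :: "'a set" and r prec :: "'a rel"
  assumes "partial_order_on P r"
    and "auxiliary_relation P r prec"
    and "A \<subseteq> P"
  shows "aux_down P prec A \<union> aux_up P r prec (P - A) = P \<and>
    (upper_set P r A \<longrightarrow>
       aux_down P prec A \<inter> aux_up P r prec (P - A) = {} \<and>
       aux_down P prec A \<union> aux_up P r prec (P - A) = P)"
  using aux_down_Un_aux_up[OF assms] aux_down_Int_aux_up[of P r A prec] by simp

end
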